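(* Let $\mathcal{R}(x)=-2\psi(x)-2\gamma$ for $x>0$. Let $n\ge 1$ be an integer and let $\theta\ge 1$ be a real number, and define $$\tilde{\mathcal{R}}_{\theta,n}(x)=\frac{1}{x^{\theta}}\left(\mathcal{R}(x)-2\sum_{k=0}^{n-1}\frac{1}{k+x}\right),\qquad x>0.$$ Then the derivative $x\mapsto\tilde{\mathcal{R}}_{\theta,n}'(x)$ is completely monotonic on $(0,\infty)$. In particular, the function $$x\mapsto\tilde{\mathcal{R}}_{1,1}(x)=\frac{x\mathcal{R}(x)-2}{x^2}$$ is increasing from $(0,\infty)$ onto $(-\pi^2/3,0)$.
   Context: $\psi(x)=\frac{d}{dx}\ln\Gamma(x)$ is the psi (digamma) function and $\gamma=-\psi(1)$ is the Euler constant. A function $f$ is completely monotonic on an interval $I$ if it has derivatives of all orders on $I$ and $(-1)^m f^{(m)}(x)\ge 0$ for all $x\in I$ and all integers $m\ge 0$. *)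

theory Defs
  imports "HOL-Analysis.Analysis"
begin

text \<open>
  \<open>D m\<close> is the \<open>m\<close>-th derivative of \<open>f\<close> on \<open>I\<close>: on a nondegenerate interval \<open>I\<close> derivatives within
  \<open>I\<close> are unique (one-sided at endpoints belonging to \<open>I\<close>), so \<open>D\<close> is determined on \<open>I\<close> by \<open>f\<close>.
\<close>
definition completely_monotonic_on :: "real set \<Rightarrow> (real \<Rightarrow> real) \<Rightarrow> bool" where
  "completely_monotonic_on I f \<longleftrightarrow>
     (\<exists>D. (\<forall>x\<in>I. D 0 x = f x) \<and>
          (\<forall>m. \<forall>x\<in>I. (D m has_real_derivative D (Suc m) x) (at x within I)) \<and>
          (\<forall>m. \<forall>x\<in>I. (-1) ^ m * D m x \<ge> 0))"

text \<open>
  \<open>Digamma\<close> is the logarithmic derivative of \<open>Gamma\<close> by \<open>has_field_derivative_ln_Gamma_real\<close> and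
  \<open>ln_Gamma_real_pos\<close>; \<open>euler_mascheroni = - Digamma 1\<close> is \<open>Digamma_1\<close>.
\<close>
definition Rfun :: "real \<Rightarrow> real" where
  "Rfun x = - 2 * Digamma x - 2 * euler_mascheroni"

definition Rtilde :: "real \<Rightarrow> nat \<Rightarrow> real \<Rightarrow> real" where
  "Rtilde \<theta> n x = 1 / x powr \<theta> * (Rfun x - 2 * (\<Sum>k<n. 1 / (real k + x)))"

end

theory Submission
  imports Defs
begin

text \<open>
  Since \<open>\<psi>(x + n) = \<psi>(x) + (\<Sum>k<n. 1 / (k + x))\<close>, the function \<open>Rtilde \<theta> n\<close> equals
  \<open>- 2 x\<^bsup>1 - \<theta>\<^esup> g(x) / x\<close> with \<open>g(x) = \<psi>(x + n) + \<gamma>\<close>. The derivative of \<open>g\<close> is completely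
  monotonic and \<open>g(0) \<ge> 0\<close>, so \<open>g(x) / x\<close> is completely monotonic: up to the positive factor
  \<open>m! / x\<^bsup>m+1\<^esup>\<close>, its \<open>m\<close>-th derivative with sign \<open>(-1)\<^bsup>m\<^esup>\<close> is the Taylor polynomial
  \<open>\<Sum>j\<le>m. g\<^bsup>(j)\<^esup>(x) (-x)\<^bsup>j\<^esup> / j!\<close>, whose derivative telescopes to \<open>(-x)\<^bsup>m\<^esup> g\<^bsup>(m+1)\<^esup>(x) / m! \<ge> 0\<close> and
  whose value at \<open>0\<close> is \<open>g(0)\<close>. As \<open>\<theta> \<ge> 1\<close>, the factor \<open>x\<^bsup>1 - \<theta>\<^esup>\<close> is completely monotonic too, and
  so is the product. For \<open>\<theta> = n = 1\<close> the function is
  \<open>- 2 (\<Sum>k. 1 / ((k + 1) (k + 1 + x)))\<close>, which runs from \<open>- 2 \<zeta>(2)\<close> to \<open>0\<close>.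
\<close>

subsection \<open>Completely monotonic functions\<close>

lemma completely_monotonic_on_cong:
  assumes "\<And>x. x \<in> I \<Longrightarrow> f x = g x"
  shows "completely_monotonic_on I f \<longleftrightarrow> completely_monotonic_on I g"
  unfolding completely_monotonic_on_def using assms by auto

lemma completely_monotonic_on_cmult:
  assumes "completely_monotonic_on I f" "c \<ge> 0"
  shows "completely_monotonic_on I (\<lambda>x. c * f x)"
proof -
  from assms(1) obtain D where D: "\<And>x. x \<in> I \<Longrightarrow> D 0 x = f x"
    "\<And>m x. x \<in> I \<Longrightarrow> (D m has_real_derivative D (Suc m) x) (at x within I)"
    "\<And>m x. x \<in> I \<Longrightarrow> (-1) ^ m * D m x \<ge> 0"
    unfolding completely_monotonic_on_def by blast
  show ?thesis
    unfolding completely_monotonic_on_def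
  proof (intro exI[of _ "\<lambda>m x. c * D m x"] conjI allI ballI)
    fix m x assume x: "x \<in> I"
    show "((\<lambda>x. c * D m x) has_real_derivative c * D (Suc m) x) (at x within I)"
      by (rule DERIV_cmult[OF D(2)[OF x]])
    have "(-1) ^ m * (c * D m x) = c * ((-1) ^ m * D m x)" by simp
    then show "(-1) ^ m * (c * D m x) \<ge> 0"
      using D(3)[OF x, of m] assms(2) by (metis mult_nonneg_nonneg)
  qed (simp add: D(1))
qed

text \<open>Pascal's rule, in the form that turns the derivative of the Leibniz expansion of order
  \<open>m\<close> into the expansion of order \<open>Suc m\<close>.\<close>

lemma Leibniz_sum_Suc:
  fixes A B :: "nat \<Rightarrow> 'a :: comm_semiring_1"
  shows "(\<Sum>k\<le>m. of_nat (m choose k) * (A (Suc k) * B (m - k) + A k * B (Suc (m - k)))) =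
         (\<Sum>k\<le>Suc m. of_nat (Suc m choose k) * (A k * B (Suc m - k)))"
proof -
  have "(\<Sum>k\<le>Suc m. of_nat (Suc m choose k) * (A k * B (Suc m - k))) =
        A 0 * B (Suc m) +
        (\<Sum>k\<le>m. of_nat (m choose k) * (A (Suc k) * B (m - k))) +
        (\<Sum>k\<le>m. of_nat (m choose Suc k) * (A (Suc k) * B (m - k)))"
    by (subst sum.atMost_Suc_shift) (simp add: algebra_simps sum.distrib)
  also have "A 0 * B (Suc m) +
        (\<Sum>k\<le>m. of_nat (m choose k) * (A (Suc k) * B (m - k))) +
        (\<Sum>k\<le>m. of_nat (m choose Suc k) * (A (Suc k) * B (m - k))) =
        (\<Sum>k\<le>m. of_nat (m choose k) * (A (Suc k) * B (m - k))) +
        (\<Sum>k\<le>Suc m. of_nat (m choose k) * (A k * B (Suc m - k)))"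
    unfolding sum.atMost_Suc_shift[of "\<lambda>k. of_nat (m choose k) * (A k * B (Suc m - k))"]
    by (simp add: algebra_simps del: sum.atMost_Suc)
  \<comment> \<open>The top term drops out because \<open>m choose Suc m\<close> is 0.\<close>
  also have "(\<Sum>k\<le>Suc m. of_nat (m choose k) * (A k * B (Suc m - k))) =
             (\<Sum>k\<le>m. of_nat (m choose k) * (A k * B (Suc (m - k))))"
    by (simp add: Suc_diff_le binomial_eq_0 cong: sum.cong_simp)
  finally show ?thesis by (simp add: algebra_simps sum.distrib)
qed

text \<open>The Leibniz formula supplies the derivatives. Splitting the sign as
  \<open>(-1) ^ k * (-1) ^ (m - k)\<close> makes every term a product of nonnegative
  factors.\<close>

lemma completely_monotonic_on_mult:
  assumes "completely_monotonic_on I f" "completely_monotonic_on I g"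
  shows "completely_monotonic_on I (\<lambda>x. f x * g x)"
proof -
  from assms(1) obtain A where A: "\<And>x. x \<in> I \<Longrightarrow> A 0 x = f x"
    "\<And>m x. x \<in> I \<Longrightarrow> (A m has_real_derivative A (Suc m) x) (at x within I)"
    "\<And>m x. x \<in> I \<Longrightarrow> (-1) ^ m * A m x \<ge> 0"
    unfolding completely_monotonic_on_def by blast
  from assms(2) obtain B where B: "\<And>x. x \<in> I \<Longrightarrow> B 0 x = g x"
    "\<And>m x. x \<in> I \<Longrightarrow> (B m has_real_derivative B (Suc m) x) (at x within I)"
    "\<And>m x. x \<in> I \<Longrightarrow> (-1) ^ m * B m x \<ge> 0"
    unfolding completely_monotonic_on_def by blast
  define D where "D m x = (\<Sum>k\<le>m. of_nat (m choose k) * (A k x * B (m - k) x))" for m x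
  show ?thesis
    unfolding completely_monotonic_on_def
  proof (intro exI[of _ D] conjI allI ballI)
    fix m x assume x: "x \<in> I"
    have "(D m has_real_derivative
        (\<Sum>k\<le>m. of_nat (m choose k) * (A (Suc k) x * B (m - k) x + A k x * B (Suc (m - k)) x)))
        (at x within I)"
      unfolding D_def
      by (rule DERIV_sum, rule DERIV_cmult, rule DERIV_cong[OF DERIV_mult[OF A(2)[OF x] B(2)[OF x]]])
         (simp add: algebra_simps)
    then show "(D m has_real_derivative D (Suc m) x) (at x within I)"
      unfolding D_def Leibniz_sum_Suc[of m "\<lambda>k. A k x" "\<lambda>k. B k x"] .
    have "(-1) ^ m * D m x =
        (\<Sum>k\<le>m. of_nat (m choose k) * (((-1) ^ k * A k x) * ((-1) ^ (m - k) * B (m - k) x)))"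
      unfolding D_def sum_distrib_left
    proof (rule sum.cong)
      fix k assume "k \<in> {..m}"
      then have "(-1::real) ^ m = (-1) ^ k * (-1) ^ (m - k)"
        by (simp flip: power_add)
      then show "(-1) ^ m * (of_nat (m choose k) * (A k x * B (m - k) x)) =
        of_nat (m choose k) * (((-1) ^ k * A k x) * ((-1) ^ (m - k) * B (m - k) x))"
        by simp
    qed simp
    also have "\<dots> \<ge> 0"
      by (intro sum_nonneg mult_nonneg_nonneg A(3) B(3) x) simp
    finally show "(-1) ^ m * D m x \<ge> 0" .
  qed (simp add: D_def A B)
qed

text \<open>The sequence of derivatives is shifted by one, which flips the sign. Openness of
  \<open>I\<close> turns derivatives within \<open>I\<close> into the two-sided ones that
  \<open>deriv\<close> refers to.\<close>

lemma completely_monotonic_on_imp_deriv: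
  assumes "completely_monotonic_on I f" "open I"
  shows "f differentiable_on I" "completely_monotonic_on I (\<lambda>x. - deriv f x)"
proof -
  from assms(1) obtain D where D: "\<And>x. x \<in> I \<Longrightarrow> D 0 x = f x"
    "\<And>m x. x \<in> I \<Longrightarrow> (D m has_real_derivative D (Suc m) x) (at x within I)"
    "\<And>m x. x \<in> I \<Longrightarrow> (-1) ^ m * D m x \<ge> 0"
    unfolding completely_monotonic_on_def by blast
  have f': "(f has_real_derivative D 1 x) (at x)" if x: "x \<in> I" for x
  proof -
    have "(D 0 has_real_derivative D 1 x) (at x)"
      using D(2)[OF x, of 0] unfolding at_within_open[OF x assms(2)] One_nat_def .
    then show ?thesis
      by (rule has_field_derivative_transform_within_open[OF _ assms(2) x]) (rule D(1))
  qed
  show "f differentiable_on I"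
    using f' by (meson differentiable_at_withinI differentiable_on_def real_differentiable_def)
  show "completely_monotonic_on I (\<lambda>x. - deriv f x)"
    unfolding completely_monotonic_on_def
  proof (intro exI[of _ "\<lambda>m x. - D (Suc m) x"] conjI allI ballI)
    fix m x assume x: "x \<in> I"
    show "((\<lambda>x. - D (Suc m) x) has_real_derivative - D (Suc (Suc m)) x) (at x within I)"
      by (rule DERIV_minus[OF D(2)[OF x]])
    show "(-1) ^ m * - D (Suc m) x \<ge> 0"
      using D(3)[OF x, of "Suc m"] by simp
  qed (simp add: DERIV_imp_deriv[OF f'])
qed

text \<open>Each differentiation brings down a factor \<open>- (a + m)\<close>, so the rising
  factorial collects the absolute values. The case \<open>a = 0\<close>, the constant 1, serves
  \<theta> = 1.\<close>

lemma completely_monotonic_on_powr: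
  assumes "a \<ge> 0"
  shows "completely_monotonic_on {0<..} (\<lambda>x. x powr - a)"
  unfolding completely_monotonic_on_def
proof (intro exI[of _ "\<lambda>m x. (-1) ^ m * pochhammer a m * x powr (- a - real m)"] conjI allI ballI)
  fix m and x :: real assume "x \<in> {0<..}"
  then have x: "x > 0" by simp
  have "((\<lambda>x. x powr (- a - real m)) has_real_derivative
        (- a - real m) * x powr (- a - real (Suc m))) (at x within {0<..})"
    using x by (auto intro!: derivative_eq_intros simp: algebra_simps)
  from DERIV_cmult[OF this, of "(-1) ^ m * pochhammer a m"]
  show "((\<lambda>x. (-1) ^ m * pochhammer a m * x powr (- a - real m)) has_real_derivative
        (-1) ^ Suc m * pochhammer a (Suc m) * x powr (- a - real (Suc m))) (at x within {0<..})"
    by (rule DERIV_cong) (simp add: pochhammer_Suc algebra_simps)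
  show "(-1) ^ m * ((-1) ^ m * pochhammer a m * x powr (- a - real m)) \<ge> 0"
    using assms by (simp flip: mult.assoc power_mult_distrib add: pochhammer_prod prod_nonneg)
qed simp

lemma completely_monotonic_on_divide_ident:
  fixes G :: "nat \<Rightarrow> real \<Rightarrow> real"
  assumes G: "\<And>m x. x \<ge> 0 \<Longrightarrow> (G m has_real_derivative G (Suc m) x) (at x)"
    and G0: "G 0 0 \<ge> 0"
    and sgn: "\<And>m x. x > 0 \<Longrightarrow> (-1) ^ m * G (Suc m) x \<ge> 0"
  shows "completely_monotonic_on {0<..} (\<lambda>x. G 0 x / x)"
proof -
  \<comment> \<open>\<open>P m x\<close> is the Taylor polynomial of \<open>G 0\<close> of degree
    \<open>m\<close> centred at \<open>x\<close>, evaluated at 0.\<close>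
  define P where "P m x = (\<Sum>j\<le>m. (-1) ^ j * G j x * x ^ j / fact j)" for m x
  have P_Suc: "P (Suc m) x = P m x + (-1) ^ Suc m * G (Suc m) x * x ^ Suc m / fact (Suc m)" for m x
    by (simp add: P_def)
  have P_deriv: "(P m has_real_derivative (-1) ^ m * G (Suc m) x * x ^ m / fact m) (at x)"
    if x: "x \<ge> 0" for m x
  proof (induction m)
    case 0
    then show ?case using G[OF x, of 0] by (simp add: P_def)
  next
    case (Suc m)
    \<comment> \<open>The cancellation behind the telescoping, with sign, powers and factorial kept
      as opaque variables.\<close>
    have eq: "s * h * X / F + - s / (n * F) * (h' * Y + n * X * h) = - s * h' * Y / (n * F)"
      if "n \<noteq> 0" "F \<noteq> 0" for s h h' n F X Y :: real
      using that by (simp add: field_simps)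
    have "((\<lambda>x. (-1) ^ Suc m / fact (Suc m) * (G (Suc m) x * x ^ Suc m)) has_real_derivative
        (-1) ^ Suc m / fact (Suc m) *
          (G (Suc (Suc m)) x * x ^ Suc m + real (Suc m) * x ^ (Suc m - Suc 0) * G (Suc m) x)) (at x)"
      by (intro DERIV_cmult DERIV_mult DERIV_pow G x)
    from DERIV_add[OF Suc this]
    have "((\<lambda>x. P m x + (-1) ^ Suc m / fact (Suc m) * (G (Suc m) x * x ^ Suc m)) has_real_derivative
        (-1) ^ Suc m * G (Suc (Suc m)) x * x ^ Suc m / fact (Suc m)) (at x)"
      by (rule DERIV_cong)
         (use eq[of "real (Suc m)" "fact m" "(-1) ^ m" "G (Suc m) x" "x ^ m" "G (Suc (Suc m)) x"
           "x ^ Suc m"] in \<open>simp del: of_nat_Suc\<close>)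
    moreover have "P (Suc m) = (\<lambda>x. P m x + (-1) ^ Suc m / fact (Suc m) * (G (Suc m) x * x ^ Suc m))"
      by (simp add: P_Suc fun_eq_iff)
    ultimately show ?case by simp
  qed
  have P_nonneg: "P m x \<ge> 0" if x: "x > 0" for m x
  proof -
    \<comment> \<open>In the derivative of \<open>P m\<close> the two factors
      \<open>(-1) ^ m\<close> and \<open>G (Suc m)\<close> have a nonnegative product by
      \<open>sgn\<close>.\<close>
    have "P m 0 \<le> P m x"
    proof (rule DERIV_nonneg_imp_increasing_open[where f = "P m"])
      fix t assume "0 < t" "t < x"
      then show "\<exists>y. (P m has_real_derivative y) (at t) \<and> y \<ge> 0"
        using P_deriv[of t m] sgn[of t m]
        by (intro exI[of _ "(-1) ^ m * G (Suc m) t * t ^ m / fact m"]) simp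
    next
      show "continuous_on {0..x} (P m)"
        using P_deriv by (intro continuous_at_imp_continuous_on ballI) (auto intro: DERIV_isCont)
    qed (use x in simp)
    moreover have "P m 0 = G 0 0"
      by (induction m) (simp_all add: P_def)
    ultimately show ?thesis using G0 by simp
  qed
  \<comment> \<open>This is the Leibniz formula for \<open>G 0 x * (1 / x)\<close> with
    \<open>(-1) ^ m * fact m / x ^ Suc m\<close> factored out.\<close>
  define D where "D m x = (-1) ^ m * fact m * P m x / x ^ Suc m" for m x
  show ?thesis
    unfolding completely_monotonic_on_def
  proof (intro exI[of _ D] conjI allI ballI)
    fix m and x :: real assume "x \<in> {0<..}"
    then have x: "x > 0" by simp
    have eq: "s * F * (((s * h * X / F) * (x * X) - q * (n * X)) / ((x * X) * (x * X))) =
        - s * (n * F) * (q + - s * h * (x * X) / (n * F)) / (x * (x * X))"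
      if "n \<noteq> 0" "F \<noteq> 0" "X \<noteq> 0" for s h q n F X :: real
      using that x by (simp add: field_simps)
    have "((\<lambda>x. (-1) ^ m * fact m * (P m x / x ^ Suc m)) has_real_derivative
        (-1) ^ m * fact m * (((-1) ^ m * G (Suc m) x * x ^ m / fact m * x ^ Suc m
          - P m x * (real (Suc m) * x ^ (Suc m - Suc 0))) / (x ^ Suc m * x ^ Suc m))) (at x)"
      using x by (intro DERIV_cmult DERIV_divide DERIV_pow P_deriv) auto
    also have "(\<lambda>x. (-1) ^ m * fact m * (P m x / x ^ Suc m)) = D m"
      by (simp add: D_def fun_eq_iff)
    also have "(-1) ^ m * fact m * (((-1) ^ m * G (Suc m) x * x ^ m / fact m * x ^ Suc m
          - P m x * (real (Suc m) * x ^ (Suc m - Suc 0))) / (x ^ Suc m * x ^ Suc m)) = D (Suc m) x"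
      using eq[of "real (Suc m)" "fact m" "x ^ m" "(-1) ^ m" "G (Suc m) x" "P m x"] x
      by (simp add: D_def P_Suc del: of_nat_Suc)
    finally show "(D m has_real_derivative D (Suc m) x) (at x within {0<..})"
      by (simp add: has_field_derivative_at_within)
    have "(-1) ^ m * D m x = fact m * P m x / x ^ Suc m"
      by (simp add: D_def flip: mult.assoc power_mult_distrib)
    then show "(-1) ^ m * D m x \<ge> 0" using P_nonneg[OF x, of m] x by simp
  qed (simp add: D_def P_def)
qed

subsection \<open>The digamma function\<close>

lemma Digamma_plus_of_nat:
  assumes "(x::real) > 0"
  shows "Digamma (x + real n) = Digamma x + (\<Sum>k<n. 1 / (real k + x))"
proof (induction n)
  case (Suc n)
  have "Digamma (x + real (Suc n)) = Digamma (x + real n + 1)" by (simp add: ac_simps)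
  also have "\<dots> = Digamma (x + real n) + 1 / (real n + x)"
    using assms by (subst Digamma_plus1) (auto simp: add.commute)
  finally show ?case using Suc by simp
qed simp

text \<open>The polygamma functions alternate in sign. The bound \<open>n \<ge> 1\<close> keeps
  \<open>x + n\<close> off the poles even at \<open>x = 0\<close>, and gives a nonnegative value
  there since \<open>Digamma 1 = - euler_mascheroni\<close> and \<open>Digamma\<close>
  increases.\<close>

lemma completely_monotonic_on_Digamma_divide:
  assumes "n \<ge> 1"
  shows "completely_monotonic_on {0<..} (\<lambda>x. (Digamma (x + real n) + euler_mascheroni) / x)"
proof -
  define G where
    "G m x = Polygamma m (x + real n) + (if m = 0 then euler_mascheroni else 0)" for m x
  have "completely_monotonic_on {0<..} (\<lambda>x. G 0 x / x)"
  proof (rule completely_monotonic_on_divide_ident)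
    fix m and x :: real assume x: "x \<ge> 0"
    have "x + real n \<notin> \<int>\<^sub>\<le>\<^sub>0" using x assms by (auto elim!: nonpos_Ints_cases')
    then show "(G m has_real_derivative G (Suc m) x) (at x)"
      unfolding G_def by (auto intro!: derivative_eq_intros)
  next
    have "Digamma 1 \<le> Digamma (real n)" using assms by (intro Digamma_real_mono) auto
    then show "G 0 0 \<ge> 0" by (simp add: G_def)
  next
    fix m and x :: real assume x: "x > 0"
    show "(-1) ^ m * G (Suc m) x \<ge> 0"
    proof (cases "even m")
      case True
      have "x + real n \<notin> \<int>\<^sub>\<le>\<^sub>0" using x by (auto elim!: nonpos_Ints_cases')
      then show ?thesis
        using True Polygamma_real_odd_pos[of "x + real n" "Suc m"] by (simp add: G_def)
    next
      case False
      then show ?thesis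
        using x Polygamma_real_even_neg[of "x + real n" "Suc m"] by (simp add: G_def)
    qed
  qed
  then show ?thesis by (simp add: G_def)
qed

section \<open>Complete monotonicity of the derivative of \<open>Rtilde\<close>\<close>

lemma Rtilde_eq:
  assumes "x > 0"
  shows "Rtilde \<theta> n x = - 2 * (x powr - (\<theta> - 1) * ((Digamma (x + real n) + euler_mascheroni) / x))"
proof -
  have "x powr - (\<theta> - 1) = x / x powr \<theta>"
    using assms by (simp add: powr_diff)
  then show ?thesis
    using assms by (simp add: Rtilde_def Rfun_def Digamma_plus_of_nat field_simps)
qed

lemma completely_monotonic_on_deriv_Rtilde:
  assumes "n \<ge> 1" "\<theta> \<ge> 1"
  shows "Rtilde \<theta> n differentiable_on {0<..}"
    "completely_monotonic_on {0<..} (deriv (Rtilde \<theta> n))"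
proof -
  have "completely_monotonic_on {0<..}
    (\<lambda>x. 2 * (x powr - (\<theta> - 1) * ((Digamma (x + real n) + euler_mascheroni) / x)))"
    using assms
    by (intro completely_monotonic_on_cmult completely_monotonic_on_mult completely_monotonic_on_powr
        completely_monotonic_on_Digamma_divide) auto
  then have cm: "completely_monotonic_on {0<..} (\<lambda>x. - Rtilde \<theta> n x)"
    by (rule completely_monotonic_on_cong[THEN iffD1, rotated]) (simp add: Rtilde_eq)
  note * = completely_monotonic_on_imp_deriv[OF cm open_greaterThan]
  show diff: "Rtilde \<theta> n differentiable_on {0<..}"
    using differentiable_on_minus[OF *(1)] by simp
  \<comment> \<open>Pulling the minus sign out of \<open>deriv\<close> uses the differentiability
    just shown.\<close>
  have "- deriv (\<lambda>x. - Rtilde \<theta> n x) x = deriv (Rtilde \<theta> n) x" if "x \<in> {0<..}" for x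
  proof -
    have "Rtilde \<theta> n field_differentiable at x"
      using diff that
      by (metis at_within_open differentiable_on_def field_differentiable_def
          open_greaterThan real_differentiable_def)
    then show ?thesis by simp
  qed
  then show "completely_monotonic_on {0<..} (deriv (Rtilde \<theta> n))"
    using *(2) by (subst completely_monotonic_on_cong[symmetric]) auto
qed

subsection \<open>The range of the function for \<open>\<theta> = n = 1\<close>\<close>

text \<open>A series for \<open>(Digamma (x + 1) + euler_mascheroni) / x\<close> that also makes
  sense at 0, where it is \<zeta>(2). It thus extends the quotient continuously to the
  endpoint.\<close>

definition Digamma_series :: "real \<Rightarrow> real" where
  "Digamma_series x = (\<Sum>k. 1 / ((real k + 1) * (real k + 1 + x)))"

text \<open>The terms \<open>1 / (k + 1) - 1 / (k + 1 + x)\<close> of the classical series have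
  numerator \<open>x\<close> over a common denominator, and the division by \<open>x\<close> cancels
  it.\<close>

lemma Digamma_series_sums:
  assumes "x > 0"
  shows "(\<lambda>k. 1 / ((real k + 1) * (real k + 1 + x))) sums
    ((Digamma (x + 1) + euler_mascheroni) / x)"
proof -
  have "(\<lambda>k. inverse (real (Suc k)) - inverse (x + 1 + real k)) sums
      (Digamma (x + 1) + euler_mascheroni)"
    using summable_sums[OF summable_Digamma[of "x + 1"]] assms by (simp add: Digamma_def)
  from sums_divide[OF this, of x] show ?thesis
  proof (rule sums_cong[THEN iffD1, rotated])
    fix k
    have "real k + 1 > 0" "real k + 1 + x > 0" using assms by auto
    then show "(inverse (real (Suc k)) - inverse (x + 1 + real k)) / x =
        1 / ((real k + 1) * (real k + 1 + x))"
      using assms by (simp add: divide_simps) (simp add: algebra_simps)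
  qed
qed

lemma Digamma_series_eq: "x > 0 \<Longrightarrow> Digamma_series x = (Digamma (x + 1) + euler_mascheroni) / x"
  unfolding Digamma_series_def by (rule sums_unique[OF Digamma_series_sums, symmetric])

text \<open>The Basel sum; the literal \<open>+ 0\<close> keeps the summand an instance of the
  general one.\<close>

lemma Digamma_series_0_sums: "(\<lambda>k. 1 / ((real k + 1) * (real k + 1 + 0))) sums (pi\<^sup>2 / 6)"
  using inverse_squares_sums
  by (simp only: power2_eq_square of_nat_add of_nat_mult of_nat_1 add_0_right)

lemma Digamma_series_0: "Digamma_series 0 = pi\<^sup>2 / 6"
  unfolding Digamma_series_def by (rule sums_unique[OF Digamma_series_0_sums, symmetric])

lemma summable_Digamma_series: "x \<ge> 0 \<Longrightarrow> summable (\<lambda>k. 1 / ((real k + 1) * (real k + 1 + x)))"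
  using Digamma_series_sums[of x] Digamma_series_0_sums sums_summable
  by (cases "x = 0") (auto simp del: add_0_right)

lemma Digamma_series_pos: "x \<ge> 0 \<Longrightarrow> Digamma_series x > 0"
  unfolding Digamma_series_def by (intro suminf_pos summable_Digamma_series) auto

text \<open>Termwise the difference is \<open>(y - x) / ((k + 1) (k + 1 + x) (k + 1 + y))\<close>,
  which is positive and at most \<open>(y - x) / (k + 1)^2\<close>. The first bound gives strict
  monotonicity, the second a Lipschitz constant.\<close>

lemma Digamma_series_diff_bounds:
  assumes "0 \<le> x" "x < y"
  shows "0 < Digamma_series x - Digamma_series y"
    "Digamma_series x - Digamma_series y \<le> (y - x) * Digamma_series 0"
proof -
  define d where "d k = 1 / ((real k + 1) * (real k + 1 + x)) - 1 / ((real k + 1) * (real k + 1 + y))"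
    for k
  have Digamma_series_diff: "Digamma_series x - Digamma_series y = suminf d" and summ: "summable d"
    unfolding Digamma_series_def d_def using assms
    by (auto intro!: suminf_diff summable_diff summable_Digamma_series)
  have d_eq: "d k = (y - x) * (1 / ((real k + 1) * (real k + 1 + x) * (real k + 1 + y)))" for k
  proof -
    have "real k + 1 > 0" "real k + 1 + x > 0" "real k + 1 + y > 0" using assms by auto
    then show ?thesis unfolding d_def by (simp add: divide_simps)
  qed
  show "0 < Digamma_series x - Digamma_series y"
    unfolding Digamma_series_diff using assms by (intro suminf_pos summ) (auto simp: d_eq)
  have "suminf d \<le> (\<Sum>k. (y - x) * (1 / ((real k + 1) * (real k + 1 + 0))))"
  proof (intro suminf_le summ summable_mult summable_Digamma_series)
    fix k
    have "(real k + 1) * (real k + 1 + 0) * 1 \<le> (real k + 1) * (real k + 1 + x) * (real k + 1 + y)"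
      using assms by (intro mult_mono) auto
    then show "d k \<le> (y - x) * (1 / ((real k + 1) * (real k + 1 + 0)))"
      unfolding d_eq using assms by (intro mult_left_mono frac_le) auto
  qed simp
  also have "\<dots> = (y - x) * Digamma_series 0"
    unfolding Digamma_series_def by (rule suminf_mult) (simp add: summable_Digamma_series del: add_0_right)
  finally show "Digamma_series x - Digamma_series y \<le> (y - x) * Digamma_series 0"
    by (simp add: Digamma_series_diff)
qed

lemma continuous_on_Digamma_series: "continuous_on {0..} Digamma_series"
proof (rule lipschitz_on_continuous_on)
  show "(Digamma_series 0)-lipschitz_on {0..} Digamma_series"
  proof (rule lipschitz_on_leI)
    show "0 \<le> Digamma_series 0" by (simp add: Digamma_series_0)
    fix x y :: real assume "x \<in> {0..}" "y \<in> {0..}" "x \<le> y"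
    then show "dist (Digamma_series x) (Digamma_series y) \<le> Digamma_series 0 * dist x y"
      using Digamma_series_diff_bounds[of x y] by (cases "x = y") (auto simp: dist_real_def mult.commute)
  qed
qed

text \<open>At a positive integer \<open>n\<close> the value is \<open>harm n / n\<close>, split
  here through \<open>ln n\<close> to use the limit defining the Euler constant. Integers suffice,
  as the intermediate value argument only needs some point with a small value.\<close>

lemma Digamma_series_of_nat_tendsto_0: "(\<lambda>n. Digamma_series (real n)) \<longlonglongrightarrow> 0"
proof -
  have "(\<lambda>n. (harm n - ln (real n)) * (1 / real n) + ln (real n) / real n)
      \<longlonglongrightarrow> euler_mascheroni * 0 + (0::real)"
    by (intro tendsto_intros euler_mascheroni_LIMSEQ lim_1_over_n lim_ln_over_n)
  then show ?thesis
  proof (rule Lim_transform_eventually[OF tendsto_eq_rhs])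
    have "(harm n - ln (real n)) * (1 / real n) + ln (real n) / real n = Digamma_series (real n)"
      if "n > 0" for n
      using that Digamma_of_nat[of n, where ?'a = real] by (simp add: Digamma_series_eq field_simps)
    then show "\<forall>\<^sub>F n in sequentially.
        (harm n - ln (real n)) * (1 / real n) + ln (real n) / real n = Digamma_series (real n)"
      using eventually_gt_at_top[of 0] by (rule eventually_mono[rotated]) auto
  qed simp
qed

lemma Digamma_series_image: "Digamma_series ` {0<..} = {0<..<pi\<^sup>2 / 6}"
proof (intro equalityI subsetI)
  fix y assume "y \<in> Digamma_series ` {0<..}"
  then obtain x where "x > 0" "y = Digamma_series x" by auto
  then show "y \<in> {0<..<pi\<^sup>2 / 6}"
    using Digamma_series_diff_bounds(1)[of 0 x] Digamma_series_pos[of x] by (simp add: Digamma_series_0)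
next
  fix y assume y: "y \<in> {0<..<pi\<^sup>2 / 6}"
  then obtain n where n: "Digamma_series (real n) < y"
    using order_tendstoD(2)[OF Digamma_series_of_nat_tendsto_0, of y]
    by (auto simp: eventually_sequentially)
  \<comment> \<open>The intermediate value theorem on \<open>{0..n}\<close>, between the value
    \<open>pi^2 / 6\<close> at 0 and a value below \<open>y\<close>; \<open>y < pi^2 / 6\<close>
    then rules out \<open>x = 0\<close>.\<close>
  have "\<exists>x\<ge>0. x \<le> real n \<and> Digamma_series x = y"
    using y n by (intro IVT2' continuous_on_subset[OF continuous_on_Digamma_series])
      (auto simp: Digamma_series_0)
  then obtain x where "x \<ge> 0" "Digamma_series x = y" by blast
  moreover from this y have "x \<noteq> 0" by (auto simp: Digamma_series_0)
  ultimately show "y \<in> Digamma_series ` {0<..}" by (intro image_eqI[of _ _ x]) auto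
qed

lemma Rtilde_1_1_eq_Digamma_series: "x > 0 \<Longrightarrow> Rtilde 1 1 x = - 2 * Digamma_series x"
  by (simp add: Rtilde_eq Digamma_series_eq)

theorem theorem4:
  "(\<forall>(n::nat) (\<theta>::real). n \<ge> 1 \<and> \<theta> \<ge> 1 \<longrightarrow>
      Rtilde \<theta> n differentiable_on {0<..} \<and>
      completely_monotonic_on {0<..} (deriv (Rtilde \<theta> n))) \<and>
   (\<forall>x>0. Rtilde 1 1 x = (x * Rfun x - 2) / x\<^sup>2) \<and>
   strict_mono_on {0<..} (Rtilde 1 1) \<and>
   Rtilde 1 1 ` {0<..} = {- (pi\<^sup>2 / 3)<..<0}"
proof (intro conjI allI impI)
  fix n :: nat and \<theta> :: real assume "n \<ge> 1 \<and> \<theta> \<ge> 1"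
  then show "Rtilde \<theta> n differentiable_on {0<..}"
    "completely_monotonic_on {0<..} (deriv (Rtilde \<theta> n))"
    using completely_monotonic_on_deriv_Rtilde by auto
next
  fix x :: real assume "x > 0"
  then show "Rtilde 1 1 x = (x * Rfun x - 2) / x\<^sup>2"
    by (simp add: Rtilde_def power2_eq_square field_simps)
next
  show "strict_mono_on {0<..} (Rtilde 1 1)"
  proof (rule strict_mono_onI)
    fix x y :: real assume "x \<in> {0<..}" "y \<in> {0<..}" "x < y"
    then show "Rtilde 1 1 x < Rtilde 1 1 y"
      using Digamma_series_diff_bounds(1)[of x y] by (simp add: Rtilde_1_1_eq_Digamma_series del: One_nat_def)
  qed
next
  have "Rtilde 1 1 ` {0<..} = (\<lambda>x. - 2 * Digamma_series x) ` {0<..}"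
    by (rule image_cong) (simp_all add: Rtilde_1_1_eq_Digamma_series del: One_nat_def)
  also have "\<dots> = (*) (- 2) ` {0<..<pi\<^sup>2 / 6}"
    by (simp add: image_image flip: Digamma_series_image)
  also have "\<dots> = {- (pi\<^sup>2 / 3)<..<0}"
  proof (intro equalityI subsetI)
    fix y assume "y \<in> {- (pi\<^sup>2 / 3)<..<0}"
    then show "y \<in> (*) (- 2) ` {0<..<pi\<^sup>2 / 6}"
      by (intro image_eqI[of _ _ "- y / 2"]) auto
  qed auto
  finally show "Rtilde 1 1 ` {0<..} = {- (pi\<^sup>2 / 3)<..<0}" .
qed

end
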